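(* Let $\kappa(t)$ be the signed curvature of the Binet-Fibonacci curve. Then for every positive integer $k$, with $n$ running over the positive integers, $$\lim_{n\to\infty}\frac{\kappa(n+k)}{\kappa(n)}=\left(-\frac{1}{\varphi^3}\right)^k .$$
   Context: Let $\varphi=\frac{1+\sqrt5}{2}$. The Binet-Fibonacci curve is the plane curve $t\mapsto (x(t),y(t))$, $t\in\mathbb{R}$, with $$x(t)=\frac{1}{\varphi+\varphi^{-1}}\left(e^{t\ln\varphi}-\cos(\pi t)e^{-t\ln\varphi}\right),\qquad y(t)=-\frac{1}{\varphi+\varphi^{-1}}\sin(\pi t)e^{-t\ln\varphi}.$$ Its signed curvature is $$\kappa(t)=\frac{\dot x(t)\ddot y(t)-\dot y(t)\ddot x(t)}{\left(\dot x(t)^2+\dot y(t)^2\right)^{3/2}}.$$ *)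

theory Defs
  imports "HOL-Analysis.Analysis"
begin

definition golden_ratio :: real
  where "golden_ratio = (1 + sqrt 5) / 2"

definition binet_x :: "real \<Rightarrow> real"
  where "binet_x t =
    1 / (golden_ratio + inverse golden_ratio) *
      (exp (t * ln golden_ratio) - cos (pi * t) * exp (- t * ln golden_ratio))"

definition binet_y :: "real \<Rightarrow> real"
  where "binet_y t =
    - (1 / (golden_ratio + inverse golden_ratio)) * sin (pi * t) * exp (- t * ln golden_ratio)"

definition signed_curvature :: "(real \<Rightarrow> real) \<Rightarrow> (real \<Rightarrow> real) \<Rightarrow> real \<Rightarrow> real"
  where "signed_curvature x y t =
    (deriv x t * deriv (deriv y) t - deriv y t * deriv (deriv x) t) /
      ((deriv x t)\<^sup>2 + (deriv y t)\<^sup>2) powr (3 / 2)"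

definition binet_curvature :: "real \<Rightarrow> real"
  where "binet_curvature = signed_curvature binet_x binet_y"

end

(* At an integer n one has sin (pi n) = 0 and cos (pi n) = (-1)^n, so the curvature there equals
   C (-1)^n phi^(-3n) g(n), where C is a constant and g(n) tends to a nonzero limit. *)
theory Submission
  imports Defs
begin

text \<open>Along the integers the curve flattens towards the x-axis: the speed grows like phi^n,
  while the numerator of the curvature stays bounded and tends to alternate in sign. Dividing by the
  cubed speed leaves (-1/phi^3)^n times a constant and a convergent correction.
  \<open>binet_curvature_nat\<close> makes this factorization exact and
  \<open>curvature_factor_limit\<close> shows that the correction has a nonzero limit, so in the
  ratio only the k-th power survives.\<close>

lemma golden_ratio_gt_1: "golden_ratio > 1"
  unfolding golden_ratio_def by (simp add: real_less_rsqrt)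

text \<open>Equality of functions, not just of values at integers, is what lets a first derivative
  be rewritten inside a second one.\<close>

lemma deriv_eqI_fun:
  assumes "\<And>t. (f has_real_derivative f' t) (at t)"
  shows "deriv f = f'"
  using assms by (auto intro!: ext DERIV_imp_deriv)

lemma deriv_binet_x:
  "deriv binet_x = (\<lambda>t. 1 / (golden_ratio + inverse golden_ratio) *
     (ln golden_ratio * exp (t * ln golden_ratio)
      + (pi * sin (pi * t) + ln golden_ratio * cos (pi * t)) * exp (- t * ln golden_ratio)))"
  unfolding binet_x_def
  by (rule deriv_eqI_fun, rule DERIV_cmult)
    (auto intro!: derivative_eq_intros simp: algebra_simps)

lemma deriv_deriv_binet_x:
  "deriv (deriv binet_x) = (\<lambda>t. 1 / (golden_ratio + inverse golden_ratio) *
     ((ln golden_ratio)\<^sup>2 * exp (t * ln golden_ratio)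
      + ((pi\<^sup>2 - (ln golden_ratio)\<^sup>2) * cos (pi * t) - 2 * pi * ln golden_ratio * sin (pi * t))
        * exp (- t * ln golden_ratio)))"
  unfolding deriv_binet_x
  by (rule deriv_eqI_fun, rule DERIV_cmult)
    (auto intro!: derivative_eq_intros simp: algebra_simps power2_eq_square)

lemma deriv_binet_y:
  "deriv binet_y = (\<lambda>t. - (1 / (golden_ratio + inverse golden_ratio)) *
     ((pi * cos (pi * t) - ln golden_ratio * sin (pi * t)) * exp (- t * ln golden_ratio)))"
  \<comment> \<open>Reassociating exposes the constant as the left factor, as
    \<open>DERIV_cmult\<close> requires.\<close>
  unfolding binet_y_def mult.assoc
  by (rule deriv_eqI_fun, rule DERIV_cmult)
    (auto intro!: derivative_eq_intros simp: algebra_simps)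

lemma deriv_deriv_binet_y:
  "deriv (deriv binet_y) = (\<lambda>t. - (1 / (golden_ratio + inverse golden_ratio)) *
     ((((ln golden_ratio)\<^sup>2 - pi\<^sup>2) * sin (pi * t) - 2 * pi * ln golden_ratio * cos (pi * t))
      * exp (- t * ln golden_ratio)))"
  unfolding deriv_binet_y
  by (rule deriv_eqI_fun, rule DERIV_cmult)
    (auto intro!: derivative_eq_intros simp: algebra_simps power2_eq_square)

text \<open>The correction left after extracting the constant and the geometric factor; it depends
  on n only through q = (-1/phi^2)^n.\<close>

definition curvature_factor :: "nat \<Rightarrow> real" where
  "curvature_factor n =
     (let L = ln golden_ratio; q = (-1) ^ n * (1 / golden_ratio\<^sup>2) ^ n
      in (3 * L\<^sup>2 + (L\<^sup>2 + pi\<^sup>2) * q) / (L\<^sup>2 * (1 + q)\<^sup>2 + pi\<^sup>2 * q\<^sup>2) powr (3 / 2))"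

lemma power2_powr_three_halves:
  fixes a :: real
  assumes "a > 0"
  shows "(a\<^sup>2) powr (3 / 2) = a ^ 3"
proof -
  have "(a\<^sup>2) powr (3 / 2) = (a powr 2) powr (3 / 2)"
    using assms by simp
  also have "\<dots> = a powr 3"
    by (simp only: powr_powr) simp
  finally show ?thesis using assms by simp
qed

text \<open>At an integer each derivative is \<open>c * E\<close> times a polynomial in
  \<open>q\<close>. The powers of \<open>c\<close> combine to 1/c = phi + 1/phi, and those of
  \<open>E\<close> leave \<open>s / E ^ 3\<close>.\<close>

lemma binet_curvature_nat:
  "binet_curvature (real n) =
     pi * (golden_ratio + inverse golden_ratio) * (- (1 / golden_ratio ^ 3)) ^ n
       * curvature_factor n"
proof -
  define L where "L = ln golden_ratio"
  define c where "c = 1 / (golden_ratio + inverse golden_ratio)"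
  define s :: real where "s = (-1) ^ n"
  define E where "E = golden_ratio ^ n"
  define D where "D = 1 / E"
  define q where "q = s * D\<^sup>2"
  define Q where "Q = L\<^sup>2 * (1 + q)\<^sup>2 + pi\<^sup>2 * q\<^sup>2"
  have c: "c > 0" and E: "E > 0"
    using golden_ratio_gt_1 by (auto simp: c_def E_def intro!: add_pos_pos)
  have DE: "D * E = 1" using E by (simp add: D_def)
  have ss: "s * s = 1" by (simp add: s_def flip: power_mult_distrib)
  have expE: "exp (real n * L) = E"
    using golden_ratio_gt_1 by (simp add: E_def L_def exp_of_nat_mult)
  have expD: "exp (- real n * L) = D"
    using expE by (simp add: D_def exp_minus field_simps)
  have cos: "cos (pi * real n) = s" and sin: "sin (pi * real n) = 0"
    by (simp_all add: s_def)
  have x': "deriv binet_x (real n) = c * L * E * (1 + q)"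
    unfolding deriv_binet_x expE expD cos sin c_def[symmetric] L_def[symmetric] q_def
    using DE by algebra
  have x'': "deriv (deriv binet_x) (real n) = c * E * (L\<^sup>2 + (pi\<^sup>2 - L\<^sup>2) * q)"
    unfolding deriv_deriv_binet_x expE expD cos sin c_def[symmetric] L_def[symmetric] q_def
    using DE by algebra
  have y': "deriv binet_y (real n) = - c * pi * E * q"
    unfolding deriv_binet_y expE expD cos sin c_def[symmetric] L_def[symmetric] q_def
    using DE by algebra
  have y'': "deriv (deriv binet_y) (real n) = 2 * c * pi * L * E * q"
    unfolding deriv_deriv_binet_y expE expD cos sin c_def[symmetric] L_def[symmetric] q_def
    using DE by algebra
  \<comment> \<open>Both \<open>y'\<close> and \<open>y''\<close> carry a factor \<open>q\<close>,
    so the growth \<open>E\<^sup>2\<close> of the numerator cancels down to the sign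
    \<open>s\<close>.\<close>
  have E2q: "E\<^sup>2 * q = s" using DE unfolding q_def by algebra
  have num: "deriv binet_x (real n) * deriv (deriv binet_y) (real n)
      - deriv binet_y (real n) * deriv (deriv binet_x) (real n)
      = c\<^sup>2 * pi * s * (3 * L\<^sup>2 + (L\<^sup>2 + pi\<^sup>2) * q)"
    unfolding x' x'' y' y'' E2q[symmetric] by algebra
  have "(deriv binet_x (real n))\<^sup>2 + (deriv binet_y (real n))\<^sup>2 = (c * E)\<^sup>2 * Q"
    unfolding x' y' Q_def by algebra
  moreover have "((c * E)\<^sup>2 * Q) powr (3 / 2) = (c * E) ^ 3 * Q powr (3 / 2)"
    using c E by (subst powr_mult) (auto simp: Q_def power2_powr_three_halves)
  ultimately have "binet_curvature (real n) =
      c\<^sup>2 * pi * s * (3 * L\<^sup>2 + (L\<^sup>2 + pi\<^sup>2) * q) / ((c * E) ^ 3 * Q powr (3 / 2))"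
    by (simp add: binet_curvature_def signed_curvature_def num)
  also have "\<dots> = pi * (1 / c) * (s / E ^ 3) * ((3 * L\<^sup>2 + (L\<^sup>2 + pi\<^sup>2) * q) / Q powr (3 / 2))"
    using c E by (simp add: power2_eq_square power3_eq_cube mult_ac)
  also have "s / E ^ 3 = (- (1 / golden_ratio ^ 3)) ^ n"
    unfolding s_def E_def
    by (subst power_minus) (simp add: power_divide mult.commute flip: power_mult)
  also have "(3 * L\<^sup>2 + (L\<^sup>2 + pi\<^sup>2) * q) / Q powr (3 / 2) = curvature_factor n"
  proof -
    have "q = (-1) ^ n * (1 / golden_ratio\<^sup>2) ^ n"
      unfolding q_def D_def E_def s_def
      by (simp add: power_divide mult.commute flip: power_mult)
    then show ?thesis
      by (simp add: curvature_factor_def Let_def Q_def L_def)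
  qed
  finally show ?thesis by (simp add: c_def)
qed

text \<open>Since 1/phi^2 < 1, q tends to 0, and continuity gives the limit 3 L^2 / (L^2)^(3/2) =
  3/L with L = ln phi > 0.\<close>

lemma curvature_factor_limit:
  obtains l where "curvature_factor \<longlonglongrightarrow> l" and "l \<noteq> 0"
proof
  define L where "L = ln golden_ratio"
  define q where "q n = (-1) ^ n * (1 / golden_ratio\<^sup>2) ^ n" for n :: nat
  have L: "L > 0" using golden_ratio_gt_1 by (simp add: L_def)
  have "q = (\<lambda>n. (- (1 / golden_ratio\<^sup>2)) ^ n)"
    by (simp add: q_def fun_eq_iff flip: power_mult_distrib)
  moreover have "\<bar>- (1 / golden_ratio\<^sup>2)\<bar> < 1"
    using golden_ratio_gt_1 by (simp add: one_less_power)
  ultimately have q: "q \<longlonglongrightarrow> 0"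
    by (metis LIMSEQ_power_zero real_norm_def)
  have "(\<lambda>n. (3 * L\<^sup>2 + (L\<^sup>2 + pi\<^sup>2) * q n) / (L\<^sup>2 * (1 + q n)\<^sup>2 + pi\<^sup>2 * (q n)\<^sup>2) powr (3 / 2))
     \<longlonglongrightarrow> (3 * L\<^sup>2 + (L\<^sup>2 + pi\<^sup>2) * 0) / (L\<^sup>2 * (1 + 0)\<^sup>2 + pi\<^sup>2 * 0\<^sup>2) powr (3 / 2)"
    using L by (intro tendsto_intros q) auto
  then show "curvature_factor \<longlonglongrightarrow> 3 * L\<^sup>2 / (L\<^sup>2) powr (3 / 2)"
    by (simp add: curvature_factor_def[abs_def] Let_def L_def q_def)
  show "3 * L\<^sup>2 / (L\<^sup>2) powr (3 / 2) \<noteq> 0" using L by simp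
qed

theorem mainTheorem4:
  fixes k :: nat
  assumes "k > 0"
  shows "(\<lambda>n::nat. binet_curvature (real (n + k)) / binet_curvature (real n))
           \<longlonglongrightarrow> (- (1 / golden_ratio ^ 3)) ^ k"
proof -
  define r where "r = - (1 / golden_ratio ^ 3)"
  obtain l where l: "curvature_factor \<longlonglongrightarrow> l" "l \<noteq> 0"
    by (rule curvature_factor_limit)
  have "r \<noteq> 0" "golden_ratio + inverse golden_ratio > 0"
    using golden_ratio_gt_1 by (auto simp: r_def intro!: add_pos_pos)
  \<comment> \<open>This holds for every n without checking
    \<open>curvature_factor n \<noteq> 0\<close>: division by zero yields 0 on both sides.\<close>
  then have "binet_curvature (real (n + k)) / binet_curvature (real n)
      = r ^ k * (curvature_factor (n + k) / curvature_factor n)" for n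
    unfolding binet_curvature_nat r_def[symmetric] power_add by simp
  moreover have "(\<lambda>n. r ^ k * (curvature_factor (n + k) / curvature_factor n))
      \<longlonglongrightarrow> r ^ k * (l / l)"
    by (intro tendsto_intros l LIMSEQ_ignore_initial_segment)
  ultimately show ?thesis using l(2) by (simp add: r_def)
qed

end
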